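(* Let $\Pi_{\rm odd}$ be the map on $\mathbb{N}=\{1,2,3,\dots\}$ produced by the following procedure. At step $1$ set $\Pi_{\rm odd}(1)=1$. For $m=2,3,4,\dots$ in turn, at step $m$: if $m$ is odd or $\Pi_{\rm odd}(m-\lfloor m/2\rfloor)$ has been assigned at an earlier step, set $\Pi_{\rm odd}(m+\lfloor m/2\rfloor)=m$; otherwise set $\Pi_{\rm odd}(m-\lfloor m/2\rfloor)=m$. Let $\sigma$ be the morphism on $\{2,3,4\}^*$ given by $\sigma(2)=322$, $\sigma(3)=324$, $\sigma(4)=324$, and let $s_{\rm odd}=s_{\rm odd}(1)s_{\rm odd}(2)\dots=324322324\dots$ be its unique fixed point (it starts with $3$). Then for every $n\ge1$: $s_{\rm odd}(n)=2$ iff $\Pi_{\rm odd}(n)$ has type (II); $s_{\rm odd}(n)=3$ iff $\Pi_{\rm odd}(n)$ has type (III); $s_{\rm odd}(n)=4$ iff $\Pi_{\rm odd}(n)$ has type (IV).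
   Context: The procedure assigns a value $\Pi_{\rm odd}(n)$ to every $n\in\mathbb{N}$. Types: for $n\ge2$, $\Pi_{\rm odd}(n)$ has type (I) if $\Pi_{\rm odd}(n)>n$ and $\Pi_{\rm odd}(n)=2n-1$; type (II) if $\Pi_{\rm odd}(n)>n$ and $\Pi_{\rm odd}(n)=2n$; type (III) if $\Pi_{\rm odd}(n)<n$ and $\Pi_{\rm odd}(n)=(2n+1)/3$; type (IV) if $\Pi_{\rm odd}(n)<n$ and $\Pi_{\rm odd}(n)=2n/3$. By definition, $\Pi_{\rm odd}(1)=1$ has type (III) (and no other type). *)

theory Defs
  imports Complex_Main "HOL-Library.Stream"
begin

(* Partial assignments of values to positions are partial maps; None means "not yet assigned". *)

definition odd_step :: "nat \<Rightarrow> (nat \<rightharpoonup> nat) \<Rightarrow> (nat \<rightharpoonup> nat)" where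
  "odd_step m st =
     (if odd m \<or> st (m - m div 2) \<noteq> None
      then st(m + m div 2 \<mapsto> m)
      else st(m - m div 2 \<mapsto> m))"

(* The assignment after step m has been carried out; the numbering of the steps starts at 1. *)
fun odd_state :: "nat \<Rightarrow> (nat \<rightharpoonup> nat)" where
  "odd_state 0 = Map.empty"
| "odd_state (Suc 0) = [1 \<mapsto> 1]"
| "odd_state (Suc (Suc m)) = odd_step (Suc (Suc m)) (odd_state (Suc m))"

(* The value that some step puts at position n. Lemma Pi_odd_well_defined below shows that every
   position n >= 1 receives a value, and never two different ones. *)
definition Pi_odd :: "nat \<Rightarrow> nat" where
  "Pi_odd n = (THE v. \<exists>m. odd_state m n = Some v)"

datatype odd_type = Type_I | Type_II | Type_III | Type_IV

(* The fractions are real, so (2n+1)/3 and 2n/3 are exact. *)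
definition has_odd_type :: "nat \<Rightarrow> odd_type \<Rightarrow> bool" where
  "has_odd_type n t \<longleftrightarrow>
     (if n = 1 then t = Type_III
      else n \<ge> 2 \<and>
        (case t of
           Type_I \<Rightarrow> Pi_odd n > n \<and> Pi_odd n = 2 * n - 1
         | Type_II \<Rightarrow> Pi_odd n > n \<and> Pi_odd n = 2 * n
         | Type_III \<Rightarrow> Pi_odd n < n \<and> real (Pi_odd n) = (2 * real n + 1) / 3
         | Type_IV \<Rightarrow> Pi_odd n < n \<and> real (Pi_odd n) = 2 * real n / 3))"

(* L2, L3, L4 stand for the letters 2, 3, 4. *)
datatype letter = L2 | L3 | L4

fun sigma :: "letter \<Rightarrow> letter list" where
  "sigma L2 = [L3, L2, L2]"
| "sigma L3 = [L3, L2, L4]"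
| "sigma L4 = [L3, L2, L4]"

(* The extension of the morphism to infinite words. *)
definition sigma_inf :: "letter stream \<Rightarrow> letter stream" where
  "sigma_inf w = flat (smap sigma w)"

(* Lemma ex1_fixed_point below shows that the fixed point exists and is unique. *)
definition fixed_word :: "letter stream" where
  "fixed_word = (THE w. sigma_inf w = w)"

(* Words are indexed from 1, streams from 0. *)
definition s_odd :: "nat \<Rightarrow> letter" where
  "s_odd n = fixed_word !! (n - 1)"

lemma odd_state_bound: "odd_state m j = Some v \<Longrightarrow> 1 \<le> j \<and> j \<le> m + m div 2"
proof (induction m arbitrary: j v rule: odd_state.induct)
  case (3 m)
  have *: "1 \<le> j \<and> j \<le> Suc (Suc m) + Suc (Suc m) div 2"
    if "odd_state (Suc m) j = Some v" for v
  proof -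
    have "Suc m div 2 \<le> Suc (Suc m) div 2" by (intro div_le_mono) simp
    with "3.IH"[OF that] show ?thesis by linarith
  qed
  show ?case
    using "3.prems" * by (auto simp: odd_step_def split: if_splits)
qed (auto split: if_splits)

lemma odd_state_Suc_keeps: "odd_state m n = Some v \<Longrightarrow> odd_state (Suc m) n = Some v"
proof (cases m)
  case (Suc k)
  assume a: "odd_state m n = Some v"
  have "n \<le> m + m div 2" using odd_state_bound[OF a] by simp
  moreover have "m div 2 \<le> Suc m div 2" by (intro div_le_mono) simp
  ultimately have "n \<noteq> Suc m + Suc m div 2" by linarith
  with a Suc show ?thesis by (auto simp: odd_step_def)
qed simp

lemma odd_state_keeps: "odd_state m n = Some v \<Longrightarrow> m \<le> m' \<Longrightarrow> odd_state m' n = Some v"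
  by (induction m' rule: nat_induct) (auto simp: le_Suc_eq intro: odd_state_Suc_keeps)

lemma odd_state_total:
  assumes "n \<ge> 1"
  shows "\<exists>v. odd_state (2 * n) n = Some v"
proof -
  from assms obtain k where n: "n = Suc k" by (cases n) auto
  have e: "2 * n = Suc (Suc (2 * k))" by (simp add: n)
  have d: "2 * n - 2 * n div 2 = n" by simp
  have "odd_state (2 * n) = odd_step (2 * n) (odd_state (Suc (2 * k)))"
    unfolding e by simp
  then show ?thesis
    by (cases "odd_state (Suc (2 * k)) n") (auto simp: odd_step_def d)
qed

lemma Pi_odd_well_defined:
  assumes "n \<ge> 1"
  shows "\<exists>!v. \<exists>m. odd_state m n = Some v"
proof -
  obtain v where v: "odd_state (2 * n) n = Some v" using odd_state_total[OF assms] by blast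
  have "u = v" if "odd_state m n = Some u" for m u
    using odd_state_keeps[OF that, of "max m (2 * n)"] odd_state_keeps[OF v, of "max m (2 * n)"]
    by simp
  with v show ?thesis by blast
qed

lemma stream_eqI: "(\<And>n. v !! n = w !! n) \<Longrightarrow> v = w"
  using smap_alt[of id v w] by (simp add: stream.map_id)

lemma length_sigma [simp]: "length (sigma x) = 3"
  by (cases x) auto

lemma sigma_nonempty: "sigma x \<noteq> []" "[] \<noteq> sigma x"
  by (cases x; simp)+

lemma snth_sigma_inf: "sigma_inf w !! n = sigma (w !! (n div 3)) ! (n mod 3)"
proof (induction n arbitrary: w rule: less_induct)
  case (less n)
  have ne: "\<forall>xs \<in> sset (smap sigma w). xs \<noteq> []"
    by (auto simp: stream.set_map sigma_nonempty)
  have step: "sigma_inf w !! n =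
      (if n < 3 then sigma (shd w) ! n else sigma_inf (stl w) !! (n - 3))"
    unfolding sigma_inf_def by (subst flat_snth[OF ne]) simp
  show ?case
  proof (cases "n < 3")
    case True
    then show ?thesis using step by simp
  next
    case False
    then obtain k where k: "n = k + 3" by (metis add.commute le_Suc_ex not_less)
    have "n div 3 = Suc (k div 3)" "n mod 3 = k mod 3" by (simp_all add: k)
    with False step less.IH[of k "stl w"] show ?thesis by (simp add: k)
  qed
qed

fun fixed_letter :: "nat \<Rightarrow> letter" where
  "fixed_letter n = (if n = 0 then L3 else sigma (fixed_letter (n div 3)) ! (n mod 3))"

declare fixed_letter.simps [simp del]

lemma ex1_fixed_point: "\<exists>!w. sigma_inf w = w"
proof (rule ex_ex1I)
  have "sigma (fixed_letter 0) ! 0 = fixed_letter 0" by (simp add: fixed_letter.simps)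
  then have "sigma (fixed_letter (n div 3)) ! (n mod 3) = fixed_letter n" for n
    by (cases "n = 0") (simp_all add: fixed_letter.simps[of n])
  then have "sigma_inf (smap fixed_letter nats) = smap fixed_letter nats"
    by (intro stream_eqI) (simp add: snth_sigma_inf)
  then show "\<exists>w. sigma_inf w = w" by blast
next
  fix v w
  assume vw: "sigma_inf v = v" "sigma_inf w = w"
  have first: "sigma x ! 0 = L3" for x by (cases x) auto
  have "v !! n = w !! n" for n
  proof (induction n rule: less_induct)
    case (less n)
    show ?case
    proof (cases "n = 0")
      case True
      then show ?thesis
        using snth_sigma_inf[of v 0] snth_sigma_inf[of w 0] vw first by simp
    next
      case False
      then have "v !! (n div 3) = w !! (n div 3)" by (intro less) simp
      then show ?thesis
        using snth_sigma_inf[of v n] snth_sigma_inf[of w n] vw by simp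
    qed
  qed
  then show "v = w" by (rule stream_eqI)
qed

end

theory Submission
  imports Defs
begin

text \<open>
  Step \<open>m\<close> writes to position \<open>\<lceil>m/2\<rceil>\<close> or to \<open>\<lfloor>3m/2\<rfloor>\<close>, so a position \<open>n \<ge> 2\<close> receives either
  \<open>2n\<close> or a value \<open>v\<close> with \<open>v + \<lfloor>v/2\<rfloor> = n\<close>. No such \<open>v\<close> exists if \<open>n \<equiv> 2\<close> modulo 3; for
  \<open>n = 3k + 1\<close> it is the odd number \<open>2k + 1\<close>, which always goes up; for \<open>n = 3k\<close> it is \<open>2k\<close>, which
  goes up iff position \<open>k\<close> was filled before step \<open>2k\<close>, that is, iff \<open>\<Pi>(k) \<noteq> 2k\<close>. This is the
  recursion of the fixed point of \<open>\<sigma>\<close>, read modulo 3.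
\<close>

lemma odd_state_step: "m \<ge> 2 \<Longrightarrow> odd_state m = odd_step m (odd_state (m - 1))"
  by (cases m rule: odd_state.cases) auto

lemma Pi_odd_eqI:
  assumes "odd_state m n = Some v"
  shows "Pi_odd n = v"
  unfolding Pi_odd_def
  using assms odd_state_bound[OF assms]
  by (intro the1_equality Pi_odd_well_defined) auto

lemma odd_state_Pi_odd: "n \<ge> 1 \<Longrightarrow> odd_state (2 * n) n = Some (Pi_odd n)"
  using odd_state_total[of n] Pi_odd_eqI[of "2 * n" n] by auto

lemma odd_state_value_bound: "odd_state m n = Some v \<Longrightarrow> v \<le> m"
proof (induction m rule: odd_state.induct)
  case (3 m)
  then show ?case by (fastforce simp: odd_step_def split: if_splits)
qed (auto split: if_splits)

text \<open>Before step 2k all values are below 2k, and assigned values persist, so k gets 2k only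
  if it is still free at step 2k. This turns the test in \<open>odd_step\<close> into a condition on
  the final map.\<close>

lemma Pi_odd_eq_double_iff:
  assumes "k \<ge> 1"
  shows "Pi_odd k = 2 * k \<longleftrightarrow> odd_state (2 * k - 1) k = None"
proof
  assume "Pi_odd k = 2 * k"
  then have "odd_state (2 * k - 1) k \<noteq> Some v" for v
    using Pi_odd_eqI odd_state_value_bound assms by fastforce
  then show "odd_state (2 * k - 1) k = None" by (cases "odd_state (2 * k - 1) k") auto
next
  assume "odd_state (2 * k - 1) k = None"
  then have "odd_state (2 * k) k = Some (2 * k)"
    using assms odd_state_step[of "2 * k"] by (auto simp: odd_step_def)
  then show "Pi_odd k = 2 * k" by (rule Pi_odd_eqI)
qed

text \<open>An even v goes up only if v/2 is already occupied, which by
  \<open>Pi_odd_eq_double_iff\<close> excludes v as the value at v/2. No reference to time remains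
  in the conclusion.\<close>

lemma odd_state_SomeE:
  assumes "odd_state m n = Some v"
  shows "v = 2 * n \<or> n = v + v div 2 \<and> (odd v \<or> Pi_odd (v div 2) \<noteq> v)"
  using assms
proof (induction m rule: odd_state.induct)
  case (3 m)
  define M where "M = Suc (Suc m)"
  have "Pi_odd (M div 2) \<noteq> M" if "even M" "odd_state (Suc m) (M - M div 2) \<noteq> None"
  proof -
    from \<open>even M\<close> obtain k where k: "M = 2 * k" by (elim evenE)
    moreover from k have "Suc m = 2 * k - 1" "k \<ge> 1" by (auto simp: M_def)
    ultimately show ?thesis using that(2) Pi_odd_eq_double_iff[of k] by simp
  qed
  moreover have "odd_step M (odd_state (Suc m)) n = Some v"
    using "3.prems" by (simp add: M_def)
  ultimately show ?case
    using "3.IH" by (auto simp: odd_step_def split: if_splits)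
qed (auto split: if_splits)

lemma Pi_odd_cases:
  assumes "n \<ge> 1"
  shows "Pi_odd n = 2 * n \<or> n = Pi_odd n + Pi_odd n div 2 \<and>
    (odd (Pi_odd n) \<or> Pi_odd (Pi_odd n div 2) \<noteq> Pi_odd n)"
  using odd_state_SomeE[OF odd_state_Pi_odd[OF assms]] .

lemma Pi_odd_3k_plus_1: "Pi_odd (3 * k + 1) = 2 * k + 1"
proof (cases "k = 0")
  \<comment> \<open>Step 1 is not an instance of \<open>odd_step\<close>.\<close>
  case True
  then show ?thesis using Pi_odd_eqI[of 1 1 1] by simp
next
  case False
  then have "odd_state (2 * k + 1) (3 * k + 1) = Some (2 * k + 1)"
    by (subst odd_state_step) (auto simp: odd_step_def)
  then show ?thesis by (rule Pi_odd_eqI)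
qed

lemma Pi_odd_3k_plus_2: "Pi_odd (3 * k + 2) = 2 * (3 * k + 2)"
proof -
  have "3 * k + 2 \<noteq> v + v div 2" for v :: nat
    by (cases "even v") (auto elim!: evenE oddE, presburger+)
  then show ?thesis using Pi_odd_cases[of "3 * k + 2"] by simp
qed

lemma Pi_odd_3k:
  assumes "k \<ge> 1"
  shows "Pi_odd (3 * k) = (if Pi_odd k = 2 * k then 6 * k else 2 * k)"
proof (cases "Pi_odd k = 2 * k")
  case True
  have v: "v = 2 * k" if "3 * k = v + v div 2" for v :: nat
    using that by (cases "even v") (auto elim!: evenE oddE)
  \<comment> \<open>A value sent up to 3k could only be 2k, but 2k has gone down to k.\<close>
  have "\<not> (odd (Pi_odd (3 * k)) \<or> Pi_odd (Pi_odd (3 * k) div 2) \<noteq> Pi_odd (3 * k))"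
    if "3 * k = Pi_odd (3 * k) + Pi_odd (3 * k) div 2"
    unfolding v[OF that] using True by simp
  then have "Pi_odd (3 * k) = 2 * (3 * k)"
    using Pi_odd_cases[of "3 * k"] assms by linarith
  then show ?thesis using True by simp
next
  case False
  then have "odd_state (2 * k) (3 * k) = Some (2 * k)"
    using Pi_odd_eq_double_iff assms by (subst odd_state_step) (auto simp: odd_step_def)
  then show ?thesis using False Pi_odd_eqI by simp
qed

lemma s_odd_rec: "s_odd (Suc n) = sigma (s_odd (Suc (n div 3))) ! (n mod 3)"
proof -
  have "sigma_inf fixed_word = fixed_word"
    unfolding fixed_word_def by (rule theI'[OF ex1_fixed_point])
  then show ?thesis using snth_sigma_inf[of fixed_word n] by (simp only: s_odd_def diff_Suc_1)
qed

text \<open>Every image under \<sigma> starts with 32; only its third letter depends on the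
  source.\<close>

lemma s_odd_3k_plus_1: "s_odd (3 * k + 1) = L3"
  using s_odd_rec[of "3 * k"] by (cases "s_odd (Suc k)") simp_all

lemma s_odd_3k_plus_2: "s_odd (3 * k + 2) = L2"
proof -
  have "(3 * k + 1) div 3 = k" "(3 * k + 1) mod 3 = 1" by presburger+
  then show ?thesis
    using s_odd_rec[of "3 * k + 1"] by (cases "s_odd (Suc k)") simp_all
qed

lemma s_odd_3k:
  assumes "k \<ge> 1"
  shows "s_odd (3 * k) = (if s_odd k = L2 then L2 else L4)"
proof -
  \<comment> \<open>Letter k has stream index j, and the last letter of its image has stream index
    3j + 2.\<close>
  from assms obtain j where k: "k = Suc j" by (cases k) auto
  then have "s_odd (3 * k) = s_odd (Suc (3 * j + 2))"
    by (intro arg_cong[of _ _ s_odd]) simp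
  moreover have "(3 * j + 2) div 3 = j" "(3 * j + 2) mod 3 = 2" by presburger+
  ultimately show ?thesis
    unfolding s_odd_rec[of "3 * j + 2"] by (cases "s_odd k") (simp_all add: k)
qed

lemma nat_mod_3_cases:
  assumes "n \<ge> (1::nat)"
  obtains (0) k where "n = 3 * k" "k \<ge> 1" | (1) k where "n = 3 * k + 1" | (2) k where "n = 3 * k + 2"
proof -
  have "\<exists>k. n = 3 * k \<and> k \<ge> 1 \<or> n = 3 * k + 1 \<or> n = 3 * k + 2" using assms by presburger
  then show thesis using that by blast
qed

text \<open>Both properties fail at 3k + 1, hold at 3k + 2, and pass unchanged between k and
  3k.\<close>

lemma s_odd_eq_L2_iff: "n \<ge> 1 \<Longrightarrow> s_odd n = L2 \<longleftrightarrow> Pi_odd n = 2 * n"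
proof (induction n rule: less_induct)
  case (less n)
  from less.prems show ?case
  proof (cases rule: nat_mod_3_cases)
    case (0 k)
    then show ?thesis using less.IH[of k] by (simp add: s_odd_3k Pi_odd_3k)
  next
    case (1 k)
    then show ?thesis using s_odd_3k_plus_1[of k] Pi_odd_3k_plus_1[of k] by simp
  next
    case (2 k)
    then show ?thesis using s_odd_3k_plus_2[of k] Pi_odd_3k_plus_2[of k] by simp
  qed
qed

theorem theorem5:
  fixes n :: nat
  assumes "n \<ge> 1"
  shows "(s_odd n = L2 \<longleftrightarrow> has_odd_type n Type_II)
       \<and> (s_odd n = L3 \<longleftrightarrow> has_odd_type n Type_III)
       \<and> (s_odd n = L4 \<longleftrightarrow> has_odd_type n Type_IV)"
  using assms
proof (cases rule: nat_mod_3_cases)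
  case (0 k)
  then show ?thesis
    using s_odd_eq_L2_iff[of k]
    by (auto simp: s_odd_3k Pi_odd_3k has_odd_type_def)
next
  \<comment> \<open>Here 2k + 1 = (2n + 1)/3; k = 0 is the conventional type of n = 1.\<close>
  case (1 k)
  then show ?thesis
    using s_odd_3k_plus_1[of k] Pi_odd_3k_plus_1[of k] by (auto simp: has_odd_type_def)
next
  case (2 k)
  then show ?thesis
    using s_odd_3k_plus_2[of k] Pi_odd_3k_plus_2[of k] by (auto simp: has_odd_type_def)
qed

end
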